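(* Let $G$ be a finite simple undirected graph that is AT-free, and let $\chi(G)$ be its chromatic number. Then $\mathrm{box}(G) \le \chi(G)$.
   Context: An asteroidal triple in $G$ is an independent set of three vertices such that between each pair of them there is a path avoiding the (open) neighbourhood of the third; $G$ is AT-free if it has no asteroidal triple. The boxicity $\mathrm{box}(G)$ is the minimum integer $k$ such that $G$ is the intersection graph of a family of axis-parallel $k$-dimensional boxes (Cartesian products $R_1\times\cdots\times R_k$ of closed real intervals), equivalently the minimum $k$ such that $G = I_1\cap\cdots\cap I_k$ for interval graphs $I_j$ on vertex set $V(G)$ (intersection meaning same vertex set and intersection of edge sets). *)

theory Defs
  imports Complex_Main "HOL-Library.FuncSet" "Graph_Theory.Digraph" "Graph_Theory.Vertex_Walk"
begin

text \<open>
  Finite simple undirected graphs are the library's \<^locale>\<open>graph\<close>: finite, loop-free,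
  symmetric digraphs without parallel arcs (the null graph is allowed).
\<close>

definition neighbourhood :: "('a,'b) pre_digraph \<Rightarrow> 'a \<Rightarrow> 'a set" where
  "neighbourhood G v = {u \<in> verts G. v \<rightarrow>\<^bsub>G\<^esub> u}"

definition independent_set :: "('a,'b) pre_digraph \<Rightarrow> 'a set \<Rightarrow> bool" where
  "independent_set G S \<longleftrightarrow> S \<subseteq> verts G \<and> (\<forall>u\<in>S. \<forall>v\<in>S. \<not> u \<rightarrow>\<^bsub>G\<^esub> v)"

definition path_avoiding :: "('a,'b) pre_digraph \<Rightarrow> 'a \<Rightarrow> 'a \<Rightarrow> 'a set \<Rightarrow> bool" where
  "path_avoiding G x y S \<longleftrightarrow>
     (\<exists>p. vpath p G \<and> hd p = x \<and> last p = y \<and> set p \<inter> S = {})"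

definition asteroidal_triple :: "('a,'b) pre_digraph \<Rightarrow> 'a \<Rightarrow> 'a \<Rightarrow> 'a \<Rightarrow> bool" where
  "asteroidal_triple G x y z \<longleftrightarrow>
     x \<noteq> y \<and> y \<noteq> z \<and> x \<noteq> z \<and> independent_set G {x, y, z} \<and>
     path_avoiding G x y (neighbourhood G z) \<and>
     path_avoiding G y z (neighbourhood G x) \<and>
     path_avoiding G x z (neighbourhood G y)"

definition AT_free :: "('a,'b) pre_digraph \<Rightarrow> bool" where
  "AT_free G \<longleftrightarrow> \<not> (\<exists>x y z. asteroidal_triple G x y z)"

definition proper_colouring :: "('a,'b) pre_digraph \<Rightarrow> nat \<Rightarrow> ('a \<Rightarrow> nat) \<Rightarrow> bool" where
  "proper_colouring G k c \<longleftrightarrow>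
     (\<forall>v\<in>verts G. c v < k) \<and>
     (\<forall>u\<in>verts G. \<forall>v\<in>verts G. u \<rightarrow>\<^bsub>G\<^esub> v \<longrightarrow> c u \<noteq> c v)"

definition chromatic_number :: "('a,'b) pre_digraph \<Rightarrow> nat" where
  "chromatic_number G = (LEAST k. \<exists>c. proper_colouring G k c)"

text \<open>
  Points of $k$-dimensional space are extensional functions on \<^term>\<open>{..<k}\<close>, so the only
  box for \<^term>\<open>k = 0\<close> is a single point, and the graphs of boxicity 0 are the complete graphs.
\<close>

definition is_box :: "nat \<Rightarrow> (nat \<Rightarrow> real) set \<Rightarrow> bool" where
  "is_box k B \<longleftrightarrow>
     (\<exists>l r. (\<forall>i<k. l i \<le> r i) \<and> B = PiE {..<k} (\<lambda>i. {l i..r i}))"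

definition box_representation ::
    "('a,'b) pre_digraph \<Rightarrow> nat \<Rightarrow> ('a \<Rightarrow> (nat \<Rightarrow> real) set) \<Rightarrow> bool" where
  "box_representation G k f \<longleftrightarrow>
     (\<forall>v\<in>verts G. is_box k (f v)) \<and>
     (\<forall>u\<in>verts G. \<forall>v\<in>verts G. u \<noteq> v \<longrightarrow> (u \<rightarrow>\<^bsub>G\<^esub> v \<longleftrightarrow> f u \<inter> f v \<noteq> {}))"

definition boxicity :: "('a,'b) pre_digraph \<Rightarrow> nat" where
  "boxicity G = (LEAST k. \<exists>f. box_representation G k f)"

lemma (in graph) chromatic_number_attained:
  "\<exists>c. proper_colouring G (chromatic_number G) c"
proof -
  obtain c where c: "bij_betw c (verts G) {0..<card (verts G)}"
    using ex_bij_betw_finite_nat[OF finite_verts] by blast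
  have "c u \<noteq> c v" if "u \<in> verts G" "v \<in> verts G" "u \<rightarrow> v" for u v
    using that c adj_not_same unfolding bij_betw_def inj_on_def by metis
  moreover have "c v < card (verts G)" if "v \<in> verts G" for v
    using c that unfolding bij_betw_def by auto
  ultimately have "\<exists>c. proper_colouring G (card (verts G)) c"
    unfolding proper_colouring_def by blast
  then show ?thesis unfolding chromatic_number_def by (rule LeastI)
qed

lemma (in graph) boxicity_attained:
  "\<exists>f. box_representation G (boxicity G) f"
proof -
  let ?n = "card (verts G)"
  obtain e where e: "bij_betw e {0..<?n} (verts G)"
    using ex_bij_betw_nat_finite[OF finite_verts] by blast
  define l :: "'a \<Rightarrow> nat \<Rightarrow> real" where "l v i = (if v = e i \<or> e i \<rightarrow> v then 0 else 1)" for v i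
  define r :: "'a \<Rightarrow> nat \<Rightarrow> real" where "r v i = (if v = e i then 0 else 1)" for v i
  define f where "f v = PiE {..<?n} (\<lambda>i. {l v i..r v i})" for v
  have meet: "f u \<inter> f v \<noteq> {} \<longleftrightarrow> (\<forall>i<?n. {l u i..r u i} \<inter> {l v i..r v i} \<noteq> {})" for u v
    unfolding f_def by (auto simp: PiE_Int PiE_eq_empty_iff)
  have "u \<rightarrow> v \<longleftrightarrow> f u \<inter> f v \<noteq> {}"
    if u: "u \<in> verts G" and v: "v \<in> verts G" and ne: "u \<noteq> v" for u v
  proof
    assume uv: "u \<rightarrow> v"
    then have vu: "v \<rightarrow> u" using arcs_ends_symmetric[OF sym_arcs] by blast
    show "f u \<inter> f v \<noteq> {}"
      unfolding meet l_def r_def using uv vu ne by auto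
  next
    assume m: "f u \<inter> f v \<noteq> {}"
    obtain i where i: "i < ?n" "e i = u"
      using e u unfolding bij_betw_def by (metis atLeastLessThan_iff imageE)
    then have "{l u i..r u i} \<inter> {l v i..r v i} \<noteq> {}" using m meet by blast
    then show "u \<rightarrow> v"
      using i ne unfolding l_def r_def by (auto split: if_splits)
  qed
  moreover have "is_box ?n (f v)" for v
    unfolding is_box_def f_def
    by (rule exI[of _ "l v"], rule exI[of _ "r v"]) (auto simp: l_def r_def)
  ultimately have "\<exists>f. box_representation G ?n f"
    unfolding box_representation_def by blast
  then show ?thesis unfolding boxicity_def by (rule LeastI)
qed

end

theory Submission
  imports Defs "Graph_Theory.Digraph_Component_Vwalk"
begin

text \<open>
  For each colour class \<open>S\<close> of an optimal colouring we find an interval supergraph of \<open>G\<close>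
  that keeps every non-edge meeting \<open>S\<close>; the intersection of these supergraphs is \<open>G\<close>.

  Say that \<open>y\<close> lies between \<open>x\<close> and \<open>z\<close> (all in \<open>S\<close>) if every path from \<open>x\<close> to \<open>z\<close> meets the
  neighbourhood of \<open>y\<close>. AT-freeness says that of any three vertices of \<open>S\<close> at least one lies
  between the others, and this, with two connectivity properties, suffices to enumerate \<open>S\<close> as
  \<open>s\<^sub>0, s\<^sub>1, \<dots>\<close> so that each vertex lies between its predecessors and its successors.

  A non-neighbour of \<open>s\<^sub>i\<close> is before \<open>s\<^sub>i\<close> if a path avoiding the neighbourhood of \<open>s\<^sub>i\<close> joins it
  to some \<open>s\<^sub>k\<close> with \<open>k < i\<close>, and after \<open>s\<^sub>i\<close> otherwise. Place \<open>s\<^sub>i\<close> at the point \<open>i\<close>, and let any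
  other vertex occupy the interval from the last \<open>j + 1/2\<close> such that it is after \<open>s\<^sub>j\<close> to the first
  \<open>i - 1/2\<close> such that it is before \<open>s\<^sub>i\<close>. Equal or adjacent vertices get intersecting intervals,
  because one of them can be before \<open>s\<^sub>i\<close> and the other after \<open>s\<^sub>j\<close> only if \<open>j < i\<close>: if \<open>i \<le> j\<close>, the
  path from \<open>s\<^sub>k\<close> that witnesses the former also avoids the neighbourhood of \<open>s\<^sub>j\<close>, as \<open>s\<^sub>i\<close> lies
  between \<open>s\<^sub>k\<close> and \<open>s\<^sub>j\<close>.
\<close>

section \<open>Betweenness relations with ties\<close>

lemma sorted_wrt_if_distinct:
  assumes "distinct xs" "\<And>x y. x \<in> set xs \<Longrightarrow> y \<in> set xs \<Longrightarrow> x \<noteq> y \<Longrightarrow> R x y"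
  shows "sorted_wrt R xs"
  using assms by (induction xs) auto

locale betweenness =
  fixes S :: "'a set" and B :: "'a \<Rightarrow> 'a \<Rightarrow> 'a \<Rightarrow> bool"
  assumes B_commute: "B x y z \<Longrightarrow> B z y x"
    and B_distinct: "B x y z \<Longrightarrow> x \<noteq> y \<and> y \<noteq> z \<and> x \<noteq> z"
    and B_split: "B x w z \<Longrightarrow> y \<in> S \<Longrightarrow> y \<noteq> w \<Longrightarrow> B x w y \<or> B y w z"
    and B_trans: "B x w y \<Longrightarrow> B x y z \<Longrightarrow> w \<noteq> z \<Longrightarrow> B x w z"
    and B_total: "x \<in> S \<Longrightarrow> y \<in> S \<Longrightarrow> z \<in> S \<Longrightarrow> x \<noteq> y \<Longrightarrow> y \<noteq> z \<Longrightarrow> x \<noteq> z \<Longrightarrow>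
      B x y z \<or> B y z x \<or> B z x y"
begin

definition strictly_nearer :: "'a \<Rightarrow> 'a \<Rightarrow> 'a \<Rightarrow> bool" where
  "strictly_nearer a y z \<longleftrightarrow> B a y z \<and> \<not> B a z y"

lemma asymp_on_strictly_nearer: "asymp_on T (strictly_nearer a)"
  by (auto simp: asymp_on_def strictly_nearer_def)

lemma transp_on_strictly_nearer: "transp_on T (strictly_nearer a)"
  unfolding transp_on_def strictly_nearer_def by (metis B_trans B_distinct)

lemma ex_farthest:
  assumes "finite T" "T \<noteq> {}"
  shows "\<exists>y\<in>T. \<forall>z\<in>T. B a y z \<longrightarrow> B a z y"
  using Finite_Set.bex_max_element
    [OF assms(1) asymp_on_strictly_nearer transp_on_strictly_nearer assms(2)]
    B_distinct unfolding strictly_nearer_def by metis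

lemma B_transfer:
  assumes "B m y z" "B x m z" "x \<in> S" "x \<noteq> y"
  shows "B x y z"
proof -
  have "B m y x \<or> B x y z"
    using B_split assms(1,3,4) by blast
  then show ?thesis
    using B_trans[of x y m z] B_commute[of m y x] assms(2) B_distinct[OF assms(1)] by blast
qed

lemma totalp_on_if_same_side:
  assumes "T \<subseteq> S" "x \<in> S - T" "a \<in> S - {x}" "\<And>z. z \<in> T \<Longrightarrow> \<not> B a x z"
  shows "totalp_on T (B x)"
proof (rule totalp_onI)
  fix z w assume zw: "z \<in> T" "w \<in> T" "z \<noteq> w"
  have "\<not> B z x w"
    using B_split[of z x w a] B_commute[of z x a] assms(3,4) zw(1,2) by blast
  then show "B x z w \<or> B x w z"
    using B_total[of x z w] B_commute[of w x z] B_commute[of z w x] assms(1,2) zw by blast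
qed

primrec between_sorted :: "'a list \<Rightarrow> bool" where
  "between_sorted [] \<longleftrightarrow> True"
| "between_sorted (x # xs) \<longleftrightarrow> sorted_wrt (B x) xs \<and> between_sorted xs"

lemma between_sorted_append:
  "between_sorted (xs @ ys) \<longleftrightarrow> between_sorted xs \<and> between_sorted ys \<and>
    (\<forall>x\<in>set xs. sorted_wrt (B x) ys) \<and> (\<forall>y\<in>set ys. sorted_wrt (\<lambda>x x'. B x x' y) xs)"
  by (induction xs) (auto simp: sorted_wrt_append)

lemma between_sorted_rev: "between_sorted xs \<Longrightarrow> between_sorted (rev xs)"
  by (induction xs)
    (auto simp: between_sorted_append sorted_wrt_rev
      elim!: sorted_wrt_mono_rel[rotated] intro: B_commute)

lemma between_sorted_nth:
  "between_sorted xs \<Longrightarrow> i < j \<Longrightarrow> j < k \<Longrightarrow> k < length xs \<Longrightarrow> B (xs ! i) (xs ! j) (xs ! k)"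
proof (induction xs arbitrary: i j k)
  case (Cons x xs)
  then obtain j' k' where "j = Suc j'" "k = Suc k'"
    by (metis less_nat_zero_code not0_implies_Suc)
  then show ?case
    using Cons by (cases i) (auto intro: sorted_wrt_nth_less)
qed simp

definition between_enumeration :: "'a set \<Rightarrow> 'a list \<Rightarrow> bool" where
  "between_enumeration T xs \<longleftrightarrow> set xs = T \<and> distinct xs \<and> between_sorted xs"

lemma between_enumeration_trivial: "between_enumeration {} []" "between_enumeration {a} [a]"
  by (simp_all add: between_enumeration_def)

lemma between_enumeration_rev: "between_enumeration T xs \<Longrightarrow> between_enumeration T (rev xs)"
  unfolding between_enumeration_def by (simp add: between_sorted_rev)

lemma between_enumeration_append:
  assumes "between_enumeration M xs" "between_enumeration N ys" "M \<inter> N = {}"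
    and "\<And>x. x \<in> M \<Longrightarrow> sorted_wrt (B x) ys"
    and "\<And>y. y \<in> N \<Longrightarrow> sorted_wrt (\<lambda>x x'. B x x' y) xs"
  shows "between_enumeration (M \<union> N) (xs @ ys)"
  using assms unfolding between_enumeration_def by (simp add: between_sorted_append)

text \<open>
  Several elements of a triple may lie between the other two, so \<open>B a\<close> is only a preorder with
  ties; a class of elements tied at the greatest distance from \<open>a\<close> can be enumerated independently
  of the rest.
\<close>

lemma farthest_class:
  assumes "finite T" "T \<subseteq> S" "a \<in> T" "T \<noteq> {a}"
  obtains M where "M \<noteq> {}" "M \<subset> T"
    "\<And>x y z. x \<in> M \<Longrightarrow> y \<in> M - {x} \<Longrightarrow> z \<in> T - M \<Longrightarrow> B x y z"
    "\<And>x. x \<in> M \<Longrightarrow> totalp_on (T - M) (B x)"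
proof -
  obtain m where m: "m \<in> T - {a}" and farthest: "\<And>z. z \<in> T - {a} \<Longrightarrow> B a m z \<Longrightarrow> B a z m"
    using ex_farthest[of "T - {a}" a] assms by blast
  define M where "M = insert m {z \<in> T. B a m z}"
  have "a \<notin> M"
    using m B_distinct unfolding M_def by blast
  have M_S: "M \<subseteq> S"
    using m assms(2) unfolding M_def by blast
  have not_beyond: "\<not> B a x z" if "x \<in> M" "z \<in> T - M" for x z
    using that B_trans[of a m x z] unfolding M_def by blast
  have tied: "B a x y" if "x \<in> M" "y \<in> M" "x \<noteq> y" for x y
  proof (cases "x = m")
    case False
    then have "B a x m"
      using that(1) farthest[of x] \<open>a \<notin> M\<close> unfolding M_def by blast
    then show ?thesis
      using B_trans[of a x m y] that(2,3) unfolding M_def by blast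
  qed (use that in \<open>auto simp: M_def\<close>)
  have "B x y z" if "x \<in> M" "y \<in> M - {x}" "z \<in> T - M" for x y z
  proof -
    have "B a y z \<or> B z y x"
      using B_split[OF tied[of y x]] that assms(2) by blast
    then show ?thesis
      using not_beyond[of y z] that B_commute[of z y x] by blast
  qed
  moreover have "totalp_on (T - M) (B x)" if x: "x \<in> M" for x
    using totalp_on_if_same_side[of "T - M" x a] not_beyond[OF x] x M_S \<open>a \<notin> M\<close> assms(2,3) by blast
  moreover have "M \<noteq> {}" "M \<subset> T"
    using m \<open>a \<notin> M\<close> assms(3) unfolding M_def by auto
  ultimately show ?thesis
    using that by simp
qed

lemma between_enumeration_append_if_tied:
  assumes "T \<subseteq> S" and M: "M \<subseteq> T" "m \<in> M"
    and tied: "\<And>x y z. x \<in> M \<Longrightarrow> y \<in> M - {x} \<Longrightarrow> z \<in> T - M \<Longrightarrow> B x y z"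
    and xs: "between_enumeration M xs"
    and ys: "between_enumeration (T - M) ys" "sorted_wrt (B m) ys"
  shows "between_enumeration T (xs @ ys)"
proof -
  have same_view: "B x y z" if "x \<in> M" "y \<in> T - M" "z \<in> T - M" "B m y z" for x y z
  proof (cases "x = m")
    case False
    then have "B x m z"
      using tied[of x m z] M(2) that by blast
    then show ?thesis
      using B_transfer[OF \<open>B m y z\<close>] that M(1) \<open>T \<subseteq> S\<close> by blast
  qed (use that in simp)
  have "between_enumeration (M \<union> (T - M)) (xs @ ys)"
  proof (rule between_enumeration_append[OF xs ys(1)])
    show "sorted_wrt (B x) ys" if "x \<in> M" for x
      using ys same_view[OF that] unfolding between_enumeration_def
      by (auto elim!: sorted_wrt_mono_rel[rotated])
    show "sorted_wrt (\<lambda>x y. B x y z) xs" if "z \<in> T - M" for z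
      using xs tied that unfolding between_enumeration_def by (intro sorted_wrt_if_distinct) auto
  qed blast
  then show ?thesis
    using M(1) by (simp add: Un_absorb1)
qed

lemma ex_between_enumeration_step:
  assumes T: "finite T" "T \<subseteq> S"
    and IH: "\<And>C. C \<subset> T \<Longrightarrow> \<exists>xs. between_enumeration C xs"
    and IH_from: "\<And>C x. C \<subset> T \<Longrightarrow> x \<in> S - C \<Longrightarrow> totalp_on C (B x) \<Longrightarrow>
      \<exists>xs. between_enumeration C xs \<and> sorted_wrt (B x) xs"
  shows "\<exists>xs. between_enumeration T xs"
proof (cases "\<exists>a\<in>T. T \<noteq> {a}")
  case False
  then have "T = {} \<or> (\<exists>a. T = {a})"
    by blast
  then show ?thesis
    using between_enumeration_trivial by metis
next
  case True
  then obtain M where M: "M \<noteq> {}" "M \<subset> T"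
    and tied: "\<And>x y z. x \<in> M \<Longrightarrow> y \<in> M - {x} \<Longrightarrow> z \<in> T - M \<Longrightarrow> B x y z"
    and total: "\<And>x. x \<in> M \<Longrightarrow> totalp_on (T - M) (B x)"
    using farthest_class[OF T] by metis
  obtain m where m: "m \<in> M"
    using M(1) by blast
  obtain xs where xs: "between_enumeration M xs"
    using IH[OF M(2)] by blast
  obtain ys where ys: "between_enumeration (T - M) ys" "sorted_wrt (B m) ys"
    using IH_from[of "T - M" m] total[OF m] m M(2) T(2) by blast
  show ?thesis
    using between_enumeration_append_if_tied[OF T(2) _ m tied xs ys] M(2) by blast
qed

definition nearest_class :: "'a \<Rightarrow> 'a set \<Rightarrow> 'a set" where
  "nearest_class a T = {x \<in> T. \<forall>y\<in>T - {x}. B a x y}"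

lemma nearest_class_nonempty:
  assumes "finite T" "T \<noteq> {}" "totalp_on T (B a)"
  shows "nearest_class a T \<noteq> {}"
proof -
  obtain x where x: "x \<in> T" and minimal: "\<And>y. y \<in> T - {x} \<Longrightarrow> \<not> strictly_nearer a y x"
    using Finite_Set.bex_min_element
      [OF assms(1) asymp_on_strictly_nearer transp_on_strictly_nearer assms(2)] by blast
  have "B a x y" if "y \<in> T - {x}" for y
    using minimal[OF that] totalp_onD[OF assms(3) x, of y] that
    unfolding strictly_nearer_def by blast
  then show ?thesis
    using x unfolding nearest_class_def by blast
qed

lemma nearest_class_not_beyond:
  assumes "x \<in> nearest_class a T" "y \<in> T - nearest_class a T"
  shows "\<not> B a y x"
proof
  assume "B a y x"
  have "B a y z" if "z \<in> T - {y}" for z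
  proof (cases "z = x")
    case False
    then have "B a x z"
      using assms(1) that unfolding nearest_class_def by blast
    then show ?thesis
      using B_trans[OF \<open>B a y x\<close>] that by blast
  qed (use \<open>B a y x\<close> in simp)
  then show False
    using assms(2) unfolding nearest_class_def by blast
qed

lemma nearest_class_view:
  assumes "x \<in> nearest_class a T" "y \<in> T - nearest_class a T" "x \<in> S" "B a y z"
  shows "B x y z"
  using B_split[OF assms(4,3)] nearest_class_not_beyond[OF assms(1,2)] assms(1,2) by blast

lemma nearest_class_total:
  assumes "T \<subseteq> S" "a \<in> S - T" "y \<in> T - nearest_class a T"
  shows "totalp_on (nearest_class a T) (B y)"
  using totalp_on_if_same_side[of "nearest_class a T" y a]
    nearest_class_not_beyond[OF _ assms(3)] assms
  unfolding nearest_class_def by blast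

lemma sorted_wrt_nearest_class:
  "between_enumeration (nearest_class a T) xs \<Longrightarrow> sorted_wrt (B a) xs"
  unfolding between_enumeration_def by (intro sorted_wrt_if_distinct) (auto simp: nearest_class_def)

lemma between_enumeration_append_nearest_class:
  fixes a T
  defines "M \<equiv> nearest_class a T"
  assumes "T \<subseteq> S" and w: "w \<in> nearest_class a (T - M)"
    and xs: "between_enumeration M xs" "sorted_wrt (B w) xs"
    and ys: "between_enumeration (T - M) ys" "sorted_wrt (B a) ys"
  shows "between_enumeration T (rev xs @ ys)" "sorted_wrt (B a) (rev xs @ ys)"
proof -
  have M: "M \<subseteq> T" "M \<subseteq> S"
    using \<open>T \<subseteq> S\<close> unfolding M_def nearest_class_def by auto
  have view: "B x y z" if "x \<in> M" "y \<in> T - M" "B a y z" for x y z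
    using nearest_class_view that M(2) unfolding M_def by blast
  have same_view: "B x' x z" if "x \<in> M" "x' \<in> M" "z \<in> T - M" "B w x x'" for x x' z
  proof (cases "z = w")
    case False
    then have "B x' w z"
      using view[of x' w z] w that(2,3) unfolding nearest_class_def by blast
    then show ?thesis
      using B_trans[of x' x w z] B_commute[of w x x'] that by blast
  qed (use that B_commute in simp)
  have "between_enumeration (M \<union> (T - M)) (rev xs @ ys)"
  proof (rule between_enumeration_append[OF between_enumeration_rev[OF xs(1)] ys(1)])
    show "sorted_wrt (B x) ys" if "x \<in> M" for x
      using ys view[OF that] unfolding between_enumeration_def
      by (auto elim!: sorted_wrt_mono_rel[rotated])
    show "sorted_wrt (\<lambda>x x'. B x x' z) (rev xs)" if "z \<in> T - M" for z
      using xs same_view[OF _ _ that] unfolding between_enumeration_def sorted_wrt_rev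
      by (auto elim!: sorted_wrt_mono_rel[rotated])
  qed blast
  then show "between_enumeration T (rev xs @ ys)"
    using M(1) by (simp add: Un_absorb1)
  have "sorted_wrt (B a) (rev xs)"
    using sorted_wrt_nearest_class between_enumeration_rev[OF xs(1)] unfolding M_def .
  moreover have "B a x y" if "x \<in> M" "y \<in> T - M" for x y
    using that unfolding M_def nearest_class_def by blast
  ultimately show "sorted_wrt (B a) (rev xs @ ys)"
    using xs(1) ys unfolding between_enumeration_def by (auto simp: sorted_wrt_append)
qed

lemma ex_between_enumeration_from_step:
  assumes T: "finite T" "T \<subseteq> S" "a \<in> S - T" "totalp_on T (B a)"
    and ex_enumeration: "\<exists>xs. between_enumeration T xs"
    and IH_from: "\<And>C x. C \<subset> T \<Longrightarrow> x \<in> S - C \<Longrightarrow> totalp_on C (B x) \<Longrightarrow>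
      \<exists>xs. between_enumeration C xs \<and> sorted_wrt (B x) xs"
  shows "\<exists>xs. between_enumeration T xs \<and> sorted_wrt (B a) xs"
proof (cases "nearest_class a T = T")
  case True
  then show ?thesis
    using ex_enumeration sorted_wrt_nearest_class by metis
next
  case False
  define M where "M = nearest_class a T"
  have M: "M \<subset> T" "M \<noteq> {}"
    using False nearest_class_nonempty[OF T(1) _ T(4)] unfolding M_def nearest_class_def by auto
  have total: "totalp_on (T - M) (B a)"
    using totalp_on_subset[OF T(4)] by blast
  obtain w where w: "w \<in> nearest_class a (T - M)"
    using nearest_class_nonempty[OF _ _ total] T(1) M(1) by blast
  then have "w \<in> T - M"
    unfolding nearest_class_def by blast
  then obtain xs where xs: "between_enumeration M xs" "sorted_wrt (B w) xs"
    using IH_from[OF M(1)] nearest_class_total[OF T(2,3), of w] T(2) unfolding M_def by blast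
  obtain ys where ys: "between_enumeration (T - M) ys" "sorted_wrt (B a) ys"
    using IH_from[OF _ _ total] M T(3) by blast
  show ?thesis
    using between_enumeration_append_nearest_class[OF T(2)] w xs ys unfolding M_def by blast
qed

lemma ex_between_enumerations:
  assumes "finite T" "T \<subseteq> S"
  shows "(\<exists>xs. between_enumeration T xs) \<and>
    (\<forall>a\<in>S - T. totalp_on T (B a) \<longrightarrow> (\<exists>xs. between_enumeration T xs \<and> sorted_wrt (B a) xs))"
  using assms
proof (induction T rule: finite_psubset_induct)
  case (psubset T)
  then have IH: "\<And>C. C \<subset> T \<Longrightarrow> \<exists>xs. between_enumeration C xs"
    and IH_from: "\<And>C x. C \<subset> T \<Longrightarrow> x \<in> S - C \<Longrightarrow> totalp_on C (B x) \<Longrightarrow>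
      \<exists>xs. between_enumeration C xs \<and> sorted_wrt (B x) xs"
    by blast+
  have "\<exists>xs. between_enumeration T xs"
    using ex_between_enumeration_step[OF psubset.hyps psubset.prems IH IH_from] .
  then show ?case
    using ex_between_enumeration_from_step[OF psubset.hyps psubset.prems _ _ _ IH_from] by blast
qed

theorem ex_between_enumeration: "finite S \<Longrightarrow> \<exists>xs. between_enumeration S xs"
  using ex_between_enumerations by blast

end

section \<open>Separation by neighbourhoods\<close>

lemma dominates_induce_subgraphI: "u \<rightarrow>\<^bsub>G\<^esub> v \<Longrightarrow> u \<in> A \<Longrightarrow> v \<in> A \<Longrightarrow> u \<rightarrow>\<^bsub>G \<restriction> A\<^esub> v"
  by (auto simp: arcs_ends_conv)

lemma (in wf_digraph) path_avoiding_if_reachable: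
  assumes "x \<rightarrow>\<^sup>*\<^bsub>G \<restriction> (verts G - N)\<^esub> y"
  shows "path_avoiding G x y N"
proof -
  interpret avoiding: wf_digraph "G \<restriction> (verts G - N)"
    by (rule wellformed_induce_subgraph)
  obtain p where p: "vpath p (G \<restriction> (verts G - N))" "hd p = x" "last p = y"
    using assms unfolding avoiding.reachable_vpath_conv by blast
  have "subgraph (G \<restriction> (verts G - N)) G"
    by (intro induced_imp_subgraph induced_induce) blast
  then have "vpath p G"
    using vpathI_subgraph[OF p(1)] by blast
  moreover have "set p \<inter> N = {}"
    using p(1) unfolding vpath_def vwalk_def by auto
  ultimately show ?thesis
    using p(2,3) unfolding path_avoiding_def by blast
qed

context sym_digraph
begin

lemma adj_sym: "u \<rightarrow> v \<Longrightarrow> v \<rightarrow> u"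
  by (rule arcs_ends_symmetric[OF sym_arcs])

definition non_neighbours :: "'a \<Rightarrow> 'a set" where
  "non_neighbours y = verts G - neighbourhood G y"

lemma mem_non_neighbours: "x \<in> non_neighbours y \<longleftrightarrow> x \<in> verts G \<and> \<not> y \<rightarrow> x"
  unfolding non_neighbours_def neighbourhood_def by blast

lemma non_neighbours_subset_verts: "non_neighbours y \<subseteq> verts G"
  unfolding non_neighbours_def by blast

lemma independent_set_subset_non_neighbours:
  assumes "independent_set G S" "y \<in> S"
  shows "S \<subseteq> non_neighbours y"
  using assms unfolding independent_set_def by (auto simp: mem_non_neighbours)

lemma sym_digraph_avoiding: "sym_digraph (G \<restriction> non_neighbours y)"
  by (intro induced_graph_imp_graph induced_induce non_neighbours_subset_verts)

lemma reachable_avoiding_or_reaches: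
  assumes "x \<rightarrow>\<^sup>*\<^bsub>G \<restriction> A\<^esub> z" "A \<subseteq> verts G" "y \<in> A"
  shows "x \<rightarrow>\<^sup>*\<^bsub>G \<restriction> A\<^esub> y \<or> x \<rightarrow>\<^sup>*\<^bsub>G \<restriction> non_neighbours y\<^esub> z"
proof -
  interpret A: wf_digraph "G \<restriction> A"
    by (rule wellformed_induce_subgraph)
  interpret avoiding: sym_digraph "G \<restriction> non_neighbours y"
    by (rule sym_digraph_avoiding)
  have reaches: "x \<rightarrow>\<^sup>*\<^bsub>G \<restriction> A\<^esub> y" if "x \<rightarrow>\<^sup>*\<^bsub>G \<restriction> A\<^esub> v" "v \<notin> non_neighbours y" for v
  proof -
    have v: "v \<in> A"
      using A.reachable_in_verts(2)[OF that(1)] by simp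
    have "v \<rightarrow> y"
      using v that(2) assms(2) adj_sym[of y v] mem_non_neighbours[of v y] by blast
    then have "v \<rightarrow>\<^bsub>G \<restriction> A\<^esub> y"
      using v assms(3) by (rule dominates_induce_subgraphI)
    then show ?thesis
      by (rule A.reachable_adj_trans[OF that(1)])
  qed
  show ?thesis
    using assms(1)
  proof (induction rule: A.reachable_induct)
    case base
    then show ?case
      using reaches[of x] A.reachable_refl[of x] avoiding.reachable_refl[of x] by fastforce
  next
    case (step u v)
    have "x \<rightarrow>\<^sup>*\<^bsub>G \<restriction> non_neighbours y\<^esub> v"
      if "x \<rightarrow>\<^sup>*\<^bsub>G \<restriction> non_neighbours y\<^esub> u" "v \<in> non_neighbours y"
    proof -
      have "u \<in> non_neighbours y"
        using avoiding.reachable_in_verts(2)[OF that(1)] by simp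
      then have "u \<rightarrow>\<^bsub>G \<restriction> non_neighbours y\<^esub> v"
        using dominates_induce_subgraphI[OF dominates_induce_subgraphD[OF step.hyps(2)]] that(2)
        by blast
      then show ?thesis
        by (rule avoiding.reachable_adj_trans[OF that(1)])
    qed
    then show ?case
      using step.IH reaches[OF A.reachable_adj_trans[OF step.hyps]] by blast
  qed
qed

definition separates :: "'a set \<Rightarrow> 'a \<Rightarrow> 'a \<Rightarrow> 'a \<Rightarrow> bool" where
  "separates S x y z \<longleftrightarrow> x \<in> S \<and> y \<in> S \<and> z \<in> S \<and> x \<noteq> y \<and> y \<noteq> z \<and> x \<noteq> z \<and>
     \<not> x \<rightarrow>\<^sup>*\<^bsub>G \<restriction> non_neighbours y\<^esub> z"

lemma AT_free_separates:
  assumes "AT_free G" "independent_set G S" "x \<in> S" "y \<in> S" "z \<in> S" "x \<noteq> y" "y \<noteq> z" "x \<noteq> z"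
  shows "separates S x y z \<or> separates S y z x \<or> separates S z x y"
proof (rule ccontr)
  assume "\<not> ?thesis"
  then have "x \<rightarrow>\<^sup>*\<^bsub>G \<restriction> non_neighbours y\<^esub> z"
      "y \<rightarrow>\<^sup>*\<^bsub>G \<restriction> non_neighbours z\<^esub> x" "z \<rightarrow>\<^sup>*\<^bsub>G \<restriction> non_neighbours x\<^esub> y"
    using assms(3-) unfolding separates_def by auto
  then have "path_avoiding G x z (neighbourhood G y)" "path_avoiding G x y (neighbourhood G z)"
    "path_avoiding G y z (neighbourhood G x)"
    using path_avoiding_if_reachable sym_digraph.symmetric_reachable'[OF sym_digraph_avoiding]
    unfolding non_neighbours_def by blast+
  moreover have "independent_set G {x, y, z}"
    using assms(2-5) unfolding independent_set_def by blast
  ultimately show False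
    using assms(1,6-8) unfolding AT_free_def asteroidal_triple_def by blast
qed

lemma betweenness_separates:
  assumes "AT_free G" and S: "independent_set G S"
  shows "betweenness S (separates S)"
proof
  interpret avoiding: sym_digraph "G \<restriction> non_neighbours y" for y
    by (rule sym_digraph_avoiding)
  show "separates S z y x" if "separates S x y z" for x y z
    using that avoiding.symmetric_reachable' unfolding separates_def by blast
  show "x \<noteq> y \<and> y \<noteq> z \<and> x \<noteq> z" if "separates S x y z" for x y z
    using that unfolding separates_def by blast
  show "separates S x w y \<or> separates S y w z"
    if "separates S x w z" "y \<in> S" "y \<noteq> w" for x w z y
    using that avoiding.reachable_trans unfolding separates_def by blast
  show "separates S x w z"
    if "separates S x w y" "separates S x y z" "w \<noteq> z" for x y z w
  proof -
    have "y \<in> non_neighbours w"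
      using independent_set_subset_non_neighbours[OF S] \<open>separates S x w y\<close>
      unfolding separates_def by blast
    then have "\<not> x \<rightarrow>\<^sup>*\<^bsub>G \<restriction> non_neighbours w\<^esub> z"
      using reachable_avoiding_or_reaches[OF _ non_neighbours_subset_verts, of w x z y] that
      unfolding separates_def by auto
    then show ?thesis
      using that unfolding separates_def by simp
  qed
  show "separates S x y z \<or> separates S y z x \<or> separates S z x y"
    if "x \<in> S" "y \<in> S" "z \<in> S" "x \<noteq> y" "y \<noteq> z" "x \<noteq> z" for x y z
    using AT_free_separates[OF assms that] .
qed

end

section \<open>Interval supergraphs\<close>

definition interval_supergraph_exact_on ::
    "('a,'b) pre_digraph \<Rightarrow> 'a set \<Rightarrow> ('a \<Rightarrow> real) \<Rightarrow> ('a \<Rightarrow> real) \<Rightarrow> bool" where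
  "interval_supergraph_exact_on G S l r \<longleftrightarrow> (\<forall>v\<in>verts G. l v \<le> r v) \<and>
    (\<forall>u v. u \<rightarrow>\<^bsub>G\<^esub> v \<longrightarrow> l u \<le> r v \<and> l v \<le> r u) \<and>
    (\<forall>u\<in>S. \<forall>v\<in>verts G. u \<noteq> v \<longrightarrow> \<not> u \<rightarrow>\<^bsub>G\<^esub> v \<longrightarrow> r u < l v \<or> r v < l u)"

lemma box_representation_if_interval_supergraphs:
  assumes cover: "verts G \<subseteq> (\<Union>i<k. S i)"
    and supergraphs: "\<And>i. i < k \<Longrightarrow> \<exists>l r. interval_supergraph_exact_on G (S i) l r"
  shows "\<exists>f. box_representation G k f"
proof -
  obtain l r where "\<And>i. i < k \<Longrightarrow> interval_supergraph_exact_on G (S i) (l i) (r i)"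
    using supergraphs by metis
  then have nonempty: "\<And>i v. i < k \<Longrightarrow> v \<in> verts G \<Longrightarrow> l i v \<le> r i v"
    and edge: "\<And>i u v. i < k \<Longrightarrow> u \<rightarrow>\<^bsub>G\<^esub> v \<Longrightarrow> l i u \<le> r i v \<and> l i v \<le> r i u"
    and non_edge: "\<And>i u v. i < k \<Longrightarrow> u \<in> S i \<Longrightarrow> v \<in> verts G \<Longrightarrow> u \<noteq> v \<Longrightarrow> \<not> u \<rightarrow>\<^bsub>G\<^esub> v \<Longrightarrow>
      r i u < l i v \<or> r i v < l i u"
    unfolding interval_supergraph_exact_on_def by simp_all
  define f where "f v = PiE {..<k} (\<lambda>i. {l i v..r i v})" for v
  have meet: "f u \<inter> f v \<noteq> {} \<longleftrightarrow> (\<forall>i<k. l i u \<le> r i v \<and> l i v \<le> r i u)"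
    if "u \<in> verts G" "v \<in> verts G" for u v
    using nonempty that unfolding f_def by (auto simp: PiE_Int PiE_eq_empty_iff)
  have "u \<rightarrow>\<^bsub>G\<^esub> v \<longleftrightarrow> f u \<inter> f v \<noteq> {}" if uv: "u \<in> verts G" "v \<in> verts G" "u \<noteq> v" for u v
  proof
    assume "u \<rightarrow>\<^bsub>G\<^esub> v"
    then show "f u \<inter> f v \<noteq> {}"
      unfolding meet[OF uv(1,2)] using edge by simp
  next
    assume "f u \<inter> f v \<noteq> {}"
    moreover obtain i where "i < k" "u \<in> S i"
      using cover uv(1) by blast
    ultimately show "u \<rightarrow>\<^bsub>G\<^esub> v"
      using non_edge[of i u v] uv(2,3) unfolding meet[OF uv(1,2)] by (meson leD)
  qed
  moreover have "is_box k (f v)" if "v \<in> verts G" for v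
    unfolding is_box_def f_def using nonempty that
    by (intro exI[of _ "\<lambda>i. l i v"] exI[of _ "\<lambda>i. r i v"]) simp
  ultimately show ?thesis
    unfolding box_representation_def by blast
qed

locale separated_sequence = sym_digraph G for G :: "('a,'b) pre_digraph" (structure) +
  fixes s :: "nat \<Rightarrow> 'a" and n :: nat
  assumes inj_s: "inj_on s {..<n}"
    and independent_s: "independent_set G (s ` {..<n})"
    and separated: "i < j \<Longrightarrow> j < k \<Longrightarrow> k < n \<Longrightarrow> \<not> s i \<rightarrow>\<^sup>*\<^bsub>G \<restriction> non_neighbours (s j)\<^esub> s k"
begin

definition before :: "'a \<Rightarrow> nat \<Rightarrow> bool" where
  "before v i \<longleftrightarrow> v \<noteq> s i \<and> (\<exists>k<i. s k \<rightarrow>\<^sup>*\<^bsub>G \<restriction> non_neighbours (s i)\<^esub> v)"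

definition after :: "'a \<Rightarrow> nat \<Rightarrow> bool" where
  "after v i \<longleftrightarrow> v \<in> non_neighbours (s i) \<and> v \<noteq> s i \<and> \<not> before v i"

lemma before_in_non_neighbours: "before v i \<Longrightarrow> v \<in> non_neighbours (s i)"
  unfolding before_def
  using wf_digraph.reachable_in_verts(2)[OF wellformed_induce_subgraph] by force

lemma s_in_non_neighbours: "i < n \<Longrightarrow> j < n \<Longrightarrow> s i \<in> non_neighbours (s j)"
  using independent_set_subset_non_neighbours[OF independent_s, of "s j"] by blast

lemma s_eq_iff: "i < n \<Longrightarrow> j < n \<Longrightarrow> s i = s j \<longleftrightarrow> i = j"
  using inj_on_eq_iff[OF inj_s] by simp

lemma s_before: "i < j \<Longrightarrow> j < n \<Longrightarrow> before (s i) j"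
  unfolding before_def
  using wf_digraph.reachable_refl[OF wellformed_induce_subgraph, of "s i" "non_neighbours (s j)"]
    s_in_non_neighbours[of i j] s_eq_iff[of i j] by auto

lemma s_after: "j < i \<Longrightarrow> i < n \<Longrightarrow> after (s i) j"
  unfolding after_def before_def
  using s_in_non_neighbours[of i j] s_eq_iff[of i j] separated by auto

lemma after_before_less:
  assumes adj: "u = v \<or> u \<rightarrow> v" and v: "after v j" and u: "before u i" and "i < n" "j < n"
  shows "j < i"
proof (rule ccontr)
  assume "\<not> j < i"
  interpret avoiding: sym_digraph "G \<restriction> non_neighbours (s j)"
    by (rule sym_digraph_avoiding)
  obtain k where k: "k < i" "s k \<rightarrow>\<^sup>*\<^bsub>G \<restriction> non_neighbours (s i)\<^esub> u"
    using u unfolding before_def by blast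
  have "s k \<rightarrow>\<^sup>*\<^bsub>G \<restriction> non_neighbours (s j)\<^esub> u"
  proof (cases "i = j")
    case False
    then have "\<not> s k \<rightarrow>\<^sup>*\<^bsub>G \<restriction> non_neighbours (s i)\<^esub> s j"
      using separated k(1) \<open>\<not> j < i\<close> \<open>j < n\<close> by simp
    then show ?thesis
      using reachable_avoiding_or_reaches[OF k(2) non_neighbours_subset_verts]
        s_in_non_neighbours[OF \<open>j < n\<close> \<open>i < n\<close>] by blast
  qed (use k(2) in simp)
  moreover have "u = v \<or> u \<rightarrow>\<^bsub>G \<restriction> non_neighbours (s j)\<^esub> v"
    using adj dominates_induce_subgraphI[of u v] avoiding.reachable_in_verts(2)[OF calculation] v
    unfolding after_def by auto
  ultimately have "s k \<rightarrow>\<^sup>*\<^bsub>G \<restriction> non_neighbours (s j)\<^esub> v"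
    using avoiding.reachable_adj_trans by blast
  then show False
    using v k(1) \<open>\<not> j < i\<close> unfolding after_def before_def by auto
qed

lemma less_if_after:
  assumes "s i = v \<or> s i \<rightarrow> v" "after v j" "j < n"
  shows "j < i"
proof -
  have "j \<noteq> i"
    using assms(1,2) unfolding after_def by (auto simp: mem_non_neighbours)
  moreover have "\<not> i < j"
    using after_before_less[OF assms(1,2), of j] s_before[of i j] assms(3) by auto
  ultimately show ?thesis
    by simp
qed

lemma less_if_before:
  assumes "u = s j \<or> u \<rightarrow> s j" "before u i" "j < n"
  shows "j < i"
proof -
  have "j \<noteq> i"
    using assms(1,2) adj_sym before_in_non_neighbours[of u i]
    unfolding before_def by (auto simp: mem_non_neighbours)
  moreover have "\<not> i < j"
    using after_before_less[OF assms(1) _ assms(2), of i] s_after[of i j] assms(3) by auto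
  ultimately show ?thesis
    by simp
qed

definition lower_bounds :: "'a \<Rightarrow> real set" where
  "lower_bounds v =
    {real i + 1/2 | i. i < n \<and> after v i} \<union> {real i | i. i < n \<and> v = s i} \<union> {-1}"

definition upper_bounds :: "'a \<Rightarrow> real set" where
  "upper_bounds v =
    {real i - 1/2 | i. i < n \<and> before v i} \<union> {real i | i. i < n \<and> v = s i} \<union> {real n}"

lemma lower_bound_le_upper_bound:
  assumes adj: "u = v \<or> u \<rightarrow> v" and "x \<in> lower_bounds v" "y \<in> upper_bounds u"
  shows "x \<le> y"
proof -
  consider (default) "x = -1 \<or> y = real n"
    | (after_before) i j where "i < n" "j < n" "after v j" "before u i"
        "x = real j + 1/2" "y = real i - 1/2"
    | (after_s) i j where "i < n" "j < n" "after v j" "u = s i" "x = real j + 1/2" "y = real i"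
    | (s_before) i j where "i < n" "j < n" "v = s j" "before u i" "x = real j" "y = real i - 1/2"
    | (s_s) i j where "i < n" "j < n" "v = s j" "u = s i" "x = real j" "y = real i"
    using assms(2,3) unfolding lower_bounds_def upper_bounds_def by blast
  then show ?thesis
  proof cases
    case default
    then show ?thesis
      using assms(2,3) unfolding lower_bounds_def upper_bounds_def by auto
  next
    case after_before
    then show ?thesis
      using after_before_less[OF adj, of j i] by linarith
  next
    case after_s
    then show ?thesis
      using less_if_after[of i v j] adj by auto
  next
    case s_before
    then show ?thesis
      using less_if_before[of u j i] adj by auto
  next
    case s_s
    then show ?thesis
      using adj s_in_non_neighbours[of j i] s_eq_iff[of i j] by (auto simp: mem_non_neighbours)
  qed
qed

lemma finite_bounds: "finite (lower_bounds v)" "finite (upper_bounds v)"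
  unfolding lower_bounds_def upper_bounds_def by simp_all

lemma bounds_nonempty: "lower_bounds v \<noteq> {}" "upper_bounds v \<noteq> {}"
  unfolding lower_bounds_def upper_bounds_def by simp_all

lemma interval_supergraph_exact_on_range:
  "interval_supergraph_exact_on G (s ` {..<n})
    (\<lambda>v. Max (lower_bounds v)) (\<lambda>v. Min (upper_bounds v))"
proof -
  define l where "l v = Max (lower_bounds v)" for v
  define r where "r v = Min (upper_bounds v)" for v
  have l_ge: "x \<le> l v" if "x \<in> lower_bounds v" for x v
    using that finite_bounds(1) unfolding l_def by simp
  have r_le: "r v \<le> x" if "x \<in> upper_bounds v" for x v
    using that finite_bounds(2) unfolding r_def by simp
  have l_le_r: "l v \<le> r u" if "u = v \<or> u \<rightarrow> v" for u v
    unfolding l_def r_def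
    by (intro lower_bound_le_upper_bound[OF that] Max_in Min_in finite_bounds bounds_nonempty)
  have "r (s i) < l v \<or> r v < l (s i)"
    if "i < n" "v \<in> verts G" "s i \<noteq> v" "\<not> s i \<rightarrow> v" for i v
  proof -
    have "real i \<le> l (s i)" "r (s i) \<le> real i"
      using \<open>i < n\<close> by (auto intro!: l_ge r_le simp: lower_bounds_def upper_bounds_def)
    moreover have "r v \<le> real i - 1/2 \<or> real i + 1/2 \<le> l v"
    proof (cases "before v i")
      case True
      then show ?thesis
        using \<open>i < n\<close> by (auto intro!: r_le simp: upper_bounds_def)
    next
      case False
      then have "after v i"
        using that unfolding after_def by (auto simp: mem_non_neighbours)
      then show ?thesis
        using \<open>i < n\<close> by (auto intro!: l_ge simp: lower_bounds_def)
    qed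
    ultimately show ?thesis
      by auto
  qed
  then have "interval_supergraph_exact_on G (s ` {..<n}) l r"
    using l_le_r adj_sym unfolding interval_supergraph_exact_on_def by auto
  then show ?thesis
    unfolding l_def r_def .
qed

end

lemma (in pseudo_graph) ex_interval_supergraph:
  assumes "AT_free G" and S: "independent_set G S"
  shows "\<exists>l r. interval_supergraph_exact_on G S l r"
proof -
  interpret betweenness S "separates S"
    using betweenness_separates[OF assms] .
  have "finite S"
    using S finite_subset unfolding independent_set_def by fastforce
  then obtain xs where xs: "set xs = S" "distinct xs" "between_sorted xs"
    using ex_between_enumeration unfolding between_enumeration_def by blast
  then have range: "(!) xs ` {..<length xs} = S"
    by (auto simp: set_conv_nth)
  interpret separated_sequence G "(!) xs" "length xs"
  proof
    show "inj_on ((!) xs) {..<length xs}"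
      using inj_on_nth[OF xs(2)] by simp
    show "independent_set G ((!) xs ` {..<length xs})"
      unfolding range by (rule S)
    show "\<not> xs ! i \<rightarrow>\<^sup>*\<^bsub>G \<restriction> non_neighbours (xs ! j)\<^esub> xs ! k"
      if "i < j" "j < k" "k < length xs" for i j k
      using between_sorted_nth[OF xs(3) that] unfolding separates_def by blast
  qed
  show ?thesis
    using interval_supergraph_exact_on_range unfolding range by blast
qed

lemma independent_set_colour_class:
  assumes "proper_colouring G k c"
  shows "independent_set G {v \<in> verts G. c v = i}"
  using assms unfolding independent_set_def proper_colouring_def by blast

lemma (in pseudo_graph) ex_box_representation_if_proper_colouring:
  assumes "AT_free G" "proper_colouring G k c"
  shows "\<exists>f. box_representation G k f"
proof (rule box_representation_if_interval_supergraphs)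
  show "verts G \<subseteq> (\<Union>i<k. {v \<in> verts G. c v = i})"
    using assms(2) unfolding proper_colouring_def by auto
  show "\<exists>l r. interval_supergraph_exact_on G {v \<in> verts G. c v = i} l r" for i
    using ex_interval_supergraph[OF assms(1) independent_set_colour_class[OF assms(2)]] .
qed

theorem theorem4:
  fixes G :: "('a,'b) pre_digraph"
  assumes "graph G"
    and "AT_free G"
  shows "boxicity G \<le> chromatic_number G"
proof -
  interpret graph G by fact
  obtain c where "proper_colouring G (chromatic_number G) c"
    using chromatic_number_attained by blast
  then have "\<exists>f. box_representation G (chromatic_number G) f"
    using ex_box_representation_if_proper_colouring \<open>AT_free G\<close> by blast
  then show ?thesis
    unfolding boxicity_def by (rule Least_le)
qed

end
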